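(* If $G$ is an $n$-vertex triangle-free plane graph in which every face has length $4$, and $G$ has no star-cutset, then $\varphi(G)=2n-5$.
   Context: Graphs are finite and simple; a plane graph is a graph with a fixed embedding in the plane. Two sets overlap if they intersect but neither contains the other. An overlap representation of a graph $G$ is an assignment $f$ of sets to the vertices of $G$ such that, for distinct vertices $u,v$, $uv\in E(G)$ if and only if $f(u)$ and $f(v)$ overlap. When the assigned sets are finite, the size of $f$ is $\left|\bigcup_{v\in V(G)} f(v)\right|$. The overlap number $\varphi(G)$ is the minimum size of an overlap representation of $G$ by finite sets. A star-cutset in $G$ is a separating set $S\subseteq V(G)$ (i.e., $G-S$ is disconnected) containing a vertex $x$ adjacent to all of $S-\{x\}$. *)

theory Defs
  imports "HOL-Analysis.Analysis"
begin

section \<open>Finite simple graphs\<close>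

definition simple_graph :: "'a set \<Rightarrow> 'a set set \<Rightarrow> bool" where
  "simple_graph V E \<longleftrightarrow> finite V \<and> (\<forall>e\<in>E. e \<subseteq> V \<and> card e = 2)"

definition triangle_free :: "'a set set \<Rightarrow> bool" where
  "triangle_free E \<longleftrightarrow> \<not> (\<exists>u v w. {u, v} \<in> E \<and> {v, w} \<in> E \<and> {u, w} \<in> E)"

definition joined :: "'a set set \<Rightarrow> 'a \<Rightarrow> 'a \<Rightarrow> bool" where
  "joined E u v \<longleftrightarrow> (u, v) \<in> {(x, y). {x, y} \<in> E}\<^sup>*"

text \<open>The graph without vertices is not disconnected, so the whole vertex set is never separating.\<close>

definition disconnected_graph :: "'a set \<Rightarrow> 'a set set \<Rightarrow> bool" where
  "disconnected_graph V E \<longleftrightarrow> (\<exists>u\<in>V. \<exists>v\<in>V. \<not> joined E u v)"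

definition separating_set :: "'a set \<Rightarrow> 'a set set \<Rightarrow> 'a set \<Rightarrow> bool" where
  "separating_set V E S \<longleftrightarrow>
     S \<subseteq> V \<and> disconnected_graph (V - S) {e \<in> E. e \<subseteq> V - S}"

definition star_cutset :: "'a set \<Rightarrow> 'a set set \<Rightarrow> 'a set \<Rightarrow> bool" where
  "star_cutset V E S \<longleftrightarrow>
     separating_set V E S \<and> (\<exists>x\<in>S. \<forall>y\<in>S - {x}. {x, y} \<in> E)"

definition cut_edge :: "'a set set \<Rightarrow> 'a set \<Rightarrow> bool" where
  "cut_edge E e \<longleftrightarrow> e \<in> E \<and> (\<exists>u\<in>e. \<exists>v\<in>e. \<not> joined (E - {e}) u v)"

section \<open>Plane graphs\<close>

text \<open>The plane is \<^typ>\<open>complex\<close>. An embedding places each vertex \<open>v\<close> at the point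
  \<open>pos v\<close> and draws each edge \<open>e\<close> as the arc \<open>curve e\<close>, whose orientation is irrelevant.\<close>

definition plane_graph ::
  "'a set \<Rightarrow> 'a set set \<Rightarrow> ('a \<Rightarrow> complex) \<Rightarrow> ('a set \<Rightarrow> real \<Rightarrow> complex) \<Rightarrow> bool" where
  "plane_graph V E pos curve \<longleftrightarrow>
     simple_graph V E \<and>
     inj_on pos V \<and>
     (\<forall>e\<in>E. arc (curve e) \<and> {pathstart (curve e), pathfinish (curve e)} = pos ` e) \<and>
     (\<forall>e\<in>E. \<forall>v\<in>V. pos v \<in> path_image (curve e) \<longrightarrow> v \<in> e) \<and>
     (\<forall>e\<in>E. \<forall>e'\<in>E. e \<noteq> e' \<longrightarrow>
        path_image (curve e) \<inter> path_image (curve e') \<subseteq> pos ` (e \<inter> e'))"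

definition drawing ::
  "'a set \<Rightarrow> 'a set set \<Rightarrow> ('a \<Rightarrow> complex) \<Rightarrow> ('a set \<Rightarrow> real \<Rightarrow> complex) \<Rightarrow> complex set" where
  "drawing V E pos curve = pos ` V \<union> (\<Union>e\<in>E. path_image (curve e))"

definition faces ::
  "'a set \<Rightarrow> 'a set set \<Rightarrow> ('a \<Rightarrow> complex) \<Rightarrow> ('a set \<Rightarrow> real \<Rightarrow> complex) \<Rightarrow> complex set set" where
  "faces V E pos curve = components (- drawing V E pos curve)"

text \<open>The length of a face is the total length of the closed walks bounding it: the number of
  edges on its boundary, with cut-edges counted twice because the walks traverse them once on
  each side.\<close>

definition boundary_edges ::
  "'a set set \<Rightarrow> ('a set \<Rightarrow> real \<Rightarrow> complex) \<Rightarrow> complex set \<Rightarrow> 'a set set" where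
  "boundary_edges E curve F = {e \<in> E. path_image (curve e) \<subseteq> frontier F}"

definition face_length ::
  "'a set set \<Rightarrow> ('a set \<Rightarrow> real \<Rightarrow> complex) \<Rightarrow> complex set \<Rightarrow> nat" where
  "face_length E curve F =
     (\<Sum>e\<in>boundary_edges E curve F. if cut_edge E e then 2 else 1)"

section \<open>Overlap representations\<close>

definition overlap :: "'b set \<Rightarrow> 'b set \<Rightarrow> bool" where
  "overlap A B \<longleftrightarrow> A \<inter> B \<noteq> {} \<and> \<not> A \<subseteq> B \<and> \<not> B \<subseteq> A"

definition overlap_representation ::
  "'a set \<Rightarrow> 'a set set \<Rightarrow> ('a \<Rightarrow> 'b set) \<Rightarrow> bool" where
  "overlap_representation V E f \<longleftrightarrow>
     (\<forall>u\<in>V. \<forall>v\<in>V. u \<noteq> v \<longrightarrow> ({u, v} \<in> E \<longleftrightarrow> overlap (f u) (f v)))"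

definition representation_size :: "'a set \<Rightarrow> ('a \<Rightarrow> 'b set) \<Rightarrow> nat" where
  "representation_size V f = card (\<Union>v\<in>V. f v)"

text \<open>Since only finitely many finite sets are assigned, their elements may be relabelled by
  natural numbers; using subsets of \<^typ>\<open>nat\<close> is therefore no restriction.\<close>

definition overlap_number :: "'a set \<Rightarrow> 'a set set \<Rightarrow> nat" where
  "overlap_number V E =
     (LEAST k. \<exists>f :: 'a \<Rightarrow> nat set.
        overlap_representation V E f \<and> (\<forall>v\<in>V. finite (f v)) \<and> representation_size V f = k)"

end

theory Submission
  imports Defs
begin

text \<open>
  The proof computes \<open>\<phi>(G) = |E| - 1\<close> from the absence of triangles and star-cutsets, and
  \<open>|E| = 2n - 4\<close> from the absence of cut-edges and the face lengths.

  A graph with an edge and without a star-cutset is connected, since deleting a single vertex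
  never separates it; with at least three vertices it also has minimum degree two and no
  cut-edge. For such a plane graph every edge lies on the boundary of exactly two faces, so that
  summing the face lengths gives \<open>4f = 2|E|\<close>, and Euler's formula \<open>n - |E| + f = 2\<close> yields
  \<open>|E| = 2n - 4\<close>.

  Both facts about faces come from one statement on crosscuts: if an arc \<open>A\<close> meets a compact set
  \<open>K\<close> exactly in its two ends, and these are joined by a path in \<open>K\<close>, then \<open>A\<close> is in the frontier of
  exactly two components of the complement of \<open>K \<union> A\<close>, and removing \<open>A\<close> merges these two. To see
  it, complete \<open>A\<close> inside \<open>K\<close> to a Jordan curve; by Janiszewski's theorem, points near an interior
  point of \<open>A\<close> and on the same side of the curve are not separated by \<open>K \<union> A\<close>
  (\<open>crosscut_local_side\<close>), and a connectedness argument along \<open>A\<close> makes the two sides global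
  (\<open>crosscut_one_side\<close>).

  For the upper bound \<open>\<phi>(G) \<le> |E| - 1\<close>, assign to every vertex the set of its incident edges and
  then complement the sets of two adjacent vertices \<open>u\<close> and \<open>v\<close>; the element \<open>uv\<close> disappears from
  all sets (\<open>overlap_flipped_incidence\<close>).

  For the lower bound (\<open>card_edges_le_size\<close>), let \<open>f\<close> be an overlap representation. As the closed
  neighbourhood of \<open>x\<close> does not separate \<open>G\<close>, the set \<open>f(x)\<close> contains either all or none of the
  sets of the non-neighbours of \<open>x\<close>. Call \<open>x\<close> big if it has non-neighbours and \<open>f(x)\<close> contains
  their sets. The sets of two non-adjacent vertices that are not big are disjoint; as \<open>G\<close> is
  triangle-free, every element lies in the sets of at most two such vertices. This provides distinct elements for all
  edges but those between big vertices. Big vertices are pairwise adjacent, so that there is at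
  most one edge between them, unless two of them are twins; in that case \<open>G\<close> has at most four
  edges.
\<close>

section \<open>Edges and walks\<close>

lemma simple_graph_edgeE:
  assumes "simple_graph V E" "e \<in> E" "a \<in> e"
  obtains b where "e = {a, b}" "a \<noteq> b" "b \<in> V"
proof -
  have "card e = 2" "e \<subseteq> V" using assms by (auto simp: simple_graph_def)
  then obtain p q where "e = {p, q}" "p \<noteq> q" by (auto simp: card_2_iff)
  then show ?thesis using that[of q] that[of p] assms(3) \<open>e \<subseteq> V\<close> by auto
qed

lemma simple_graph_edgeD:
  assumes "simple_graph V E" "{a, b} \<in> E"
  shows "a \<in> V" "b \<in> V" "a \<noteq> b"
  using assms by (auto simp: simple_graph_def)

lemma simple_graph_finite_edges: "simple_graph V E \<Longrightarrow> finite E"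
  by (rule finite_subset[of _ "Pow V"]) (auto simp: simple_graph_def)

lemma triangle_freeD: "triangle_free E \<Longrightarrow> {a, b} \<in> E \<Longrightarrow> {b, c} \<in> E \<Longrightarrow> {a, c} \<in> E \<Longrightarrow> False"
  by (auto simp: triangle_free_def)

lemma joined_refl [simp]: "joined E u u"
  by (simp add: joined_def)

lemma joined_edge: "{u, v} \<in> E \<Longrightarrow> joined E u v"
  by (auto simp: joined_def)

lemma joined_trans: "joined E u v \<Longrightarrow> joined E v w \<Longrightarrow> joined E u w"
  by (auto simp: joined_def)

lemma joined_sym: "joined E u v \<Longrightarrow> joined E v u"
proof -
  have "sym ({(x, y). {x, y} \<in> E}\<^sup>*)" by (rule sym_rtrancl) (auto simp: sym_def insert_commute)
  then show "joined E u v \<Longrightarrow> joined E v u" by (auto simp: joined_def dest: symD)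
qed

lemma joined_mono: "joined E u v \<Longrightarrow> E \<subseteq> E' \<Longrightarrow> joined E' u v"
  unfolding joined_def by (rule set_mp[OF rtrancl_mono]) auto

lemma joined_exit:
  assumes "joined E u v" "u \<in> W" "v \<notin> W"
  obtains x y where "x \<in> W" "y \<notin> W" "{x, y} \<in> E"
proof -
  have "(u, v) \<in> {(x, y). {x, y} \<in> E}\<^sup>*" using assms by (simp add: joined_def)
  then have "v \<in> W \<or> (\<exists>x y. x \<in> W \<and> y \<notin> W \<and> {x, y} \<in> E)"
    by (induction rule: rtrancl_induct) (use assms in auto)
  then show ?thesis using that assms by auto
qed

section \<open>Crosscuts of compact sets in the plane\<close>

text \<open>The components of an open set after the insertion or deletion of an arc are identified by this
  criterion: a connected set cannot leave a block of an open partition.\<close>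

lemma components_eq_open_partition:
  assumes "\<Union>\<U> = S" and disj: "pairwise disjnt \<U>"
    and \<U>: "\<And>X. X \<in> \<U> \<Longrightarrow> open X \<and> connected X \<and> X \<noteq> {}"
  shows "components S = \<U>"
proof -
  have comp: "X \<in> components S" if X: "X \<in> \<U>" for X
    unfolding in_components_maximal
  proof (intro conjI allI impI)
    show "X \<noteq> {}" "X \<subseteq> S" "connected X" using \<U>[OF X] X assms(1) by auto
  next
    fix D assume D: "D \<noteq> {} \<and> X \<subseteq> D \<and> D \<subseteq> S \<and> connected D"
    define R where "R = \<Union>(\<U> - {X})"
    have "open X" "open R" using \<U> X by (auto simp: R_def)
    moreover have "X \<inter> R = {}"
      using disj X by (auto simp: R_def pairwise_def disjnt_def)
    moreover have "D \<subseteq> X \<union> R" using D assms(1) by (auto simp: R_def)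
    moreover have "X \<inter> D \<noteq> {}" using D \<U>[OF X] by auto
    ultimately have "R \<inter> D = {}" using D connectedD[of D X R] by blast
    then show "D = X" using \<open>D \<subseteq> X \<union> R\<close> D by blast
  qed
  have "X \<in> \<U>" if X: "X \<in> components S" for X
  proof -
    obtain x where "x \<in> X" using in_components_nonempty[OF X] by auto
    then obtain Y where Y: "Y \<in> \<U>" "x \<in> Y"
      using in_components_subset[OF X] assms(1) by auto
    then show ?thesis using components_eq[OF X comp[OF Y(1)]] \<open>x \<in> X\<close> by auto
  qed
  with comp show ?thesis by blast
qed

lemma arc_interior_eq:
  fixes g :: "real \<Rightarrow> complex"
  assumes "arc g" "path_image g \<inter> K = {pathstart g, pathfinish g}"
  shows "path_image g - K = g ` {0<..<1}"
proof -
  have "path_image g - {pathstart g, pathfinish g} = g ` {0<..<1}"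
    using simple_path_endless[OF arc_imp_simple_path[OF assms(1)]] by auto
  with assms(2) show ?thesis by blast
qed

text \<open>Janiszewski's theorem is applied to the Jordan curve \<open>C\<close> formed by \<open>g\<close> and \<open>h\<close>, and to the union of
  \<open>R\<close> with the complement of a neighbourhood \<open>D\<close> of \<open>z\<close> that misses \<open>K\<close>, where \<open>R\<close> is \<open>C\<close> without a
  short open subarc around \<open>z\<close> inside \<open>D\<close>. These two sets meet in the connected set \<open>R\<close>, and points
  close to \<open>z\<close> are not separated by the second one. So if the curve does not separate them either,
  then they can be joined inside \<open>D\<close> without crossing \<open>C\<close>, and there \<open>K \<union> g\<close> is contained in
  \<open>C\<close>.\<close>

lemma crosscut_local_side:
  fixes g h :: "real \<Rightarrow> complex"
  assumes K: "compact K" and g: "arc g" and gK: "path_image g \<inter> K = {pathstart g, pathfinish g}"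
    and h: "arc h" "path_image h \<subseteq> K" "pathstart h = pathfinish g" "pathfinish h = pathstart g"
    and z: "z \<in> path_image g - K"
  obtains N where "open N" "z \<in> N" "N \<inter> K = {}"
    "\<And>x y. \<lbrakk>x \<in> N; y \<in> N; connected_component (- path_image (g +++ h)) x y\<rbrakk>
       \<Longrightarrow> connected_component (- (K \<union> path_image g)) x y"
proof -
  let ?C = "path_image (g +++ h)"
  have C: "?C = path_image g \<union> path_image h"
    using h by (simp add: path_image_join)
  have pg: "path g" and ph: "path h" using g h by (auto simp: arc_imp_path)
  obtain t where t: "t \<in> {0<..<1}" "z = g t"
    using z arc_interior_eq[OF g gK] by auto
  obtain D where D: "open D" "z \<in> D" "D \<inter> K = {}"
    using K z by (intro that[of "- K"]) (auto simp: compact_imp_closed)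
  have "continuous_on {0..1} g" using pg by (simp add: path_def)
  then have "continuous (at t) g"
    using t continuous_on_interior[of "{0..1}" g t] by simp
  then obtain d0 where d0: "d0 > 0" "\<And>s. dist s t < d0 \<Longrightarrow> g s \<in> D"
    using D t unfolding continuous_at_open[of t g] 
    by (metis open_dist)
  \<comment> \<open>Small enough for the short subarc to lie in the neighbourhood and to stay away from both ends.\<close>
  define d where "d = min (d0 / 2) (min (t / 2) ((1 - t) / 2))"
  have d: "0 < d" "d < d0" "0 < t - d" "t + d < 1"
    using d0 t by (auto simp: d_def min_def field_simps)
  define R where "R = g ` {0..t - d} \<union> g ` {t + d..1} \<union> path_image h"
  have Cdiff: "?C - R \<subseteq> D"
  proof
    fix w assume w: "w \<in> ?C - R"
    then have "w \<in> path_image g" using C by (auto simp: R_def)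
    then obtain s where s: "s \<in> {0..1}" "w = g s" by (auto simp: path_image_def)
    with w have "\<not> s \<le> t - d" "\<not> t + d \<le> s" by (auto simp: R_def)
    then show "w \<in> D" using s d d0(2)[of s] by (auto simp: dist_real_def)
  qed
  have RC: "R \<subseteq> ?C" unfolding C using d t by (auto simp: R_def path_image_def)
  have conR: "connected R"
  proof -
    have sub: "continuous_on {0..t - d} g" "continuous_on {t + d..1} g"
      using \<open>continuous_on {0..1} g\<close> d t by (auto elim: continuous_on_subset)
    have c1: "connected (g ` {0..t - d})" "connected (g ` {t + d..1})" "connected (path_image h)"
      using sub by (auto intro: connected_continuous_image connected_path_image ph)
    have m1: "g 0 \<in> g ` {0..t - d} \<inter> path_image h"
      using d h pathfinish_in_path_image[of h] by (auto simp: pathstart_def)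
    have "g 1 \<in> g ` {t + d..1} \<inter> path_image h"
      using d h pathstart_in_path_image[of h] by (auto simp: pathfinish_def)
    then have "connected (g ` {t + d..1} \<union> path_image h)"
      using c1 by (intro connected_Un) auto
    then have "connected (g ` {0..t - d} \<union> (g ` {t + d..1} \<union> path_image h))"
      by (rule connected_Un[OF c1(1)]) (use m1 in blast)
    then show ?thesis by (simp add: R_def Un_assoc)
  qed
  have cloR: "closed R"
    unfolding R_def using \<open>continuous_on {0..1} g\<close> d t h(1)
    by (intro closed_Un compact_imp_closed compact_continuous_image closed_arc_image)
       (auto elim: continuous_on_subset)
  have zR: "z \<notin> R"
  proof
    assume "z \<in> R"
    then consider s where "s \<in> {0..t - d} \<union> {t + d..1}" "g t = g s" | "z \<in> path_image h"
      unfolding R_def t(2) by blast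
    then show False
    proof cases
      case 1
      have "inj_on g {0..1}" using g by (simp add: arc_def)
      then have "t = s" using 1 t d by (auto simp: inj_on_def)
      then show False using 1 d by auto
    next
      case 2 then show False using z h(2) by auto
    qed
  qed
  obtain r where r: "r > 0" "ball z r \<subseteq> D - R"
    using D cloR zR open_Diff[of D R] by (metis DiffI open_contains_ball)
  show ?thesis
  proof (rule that[of "ball z r"])
    fix x y
    assume x: "x \<in> ball z r" and y: "y \<in> ball z r" and xy: "connected_component (- ?C) x y"
    have "connected_component (- (?C \<union> (- D \<union> R))) x y"
    proof (rule Janiszewski)
      show "compact ?C" using pg ph h by (simp add: compact_path_image)
      show "closed (- D \<union> R)" using D cloR by auto
      have "?C \<inter> (- D \<union> R) = R" using Cdiff RC by blast
      then show "connected (?C \<inter> (- D \<union> R))" using conR by simp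
      show "connected_component (- (- D \<union> R)) x y"
        unfolding connected_component_def using r x y by (intro exI[of _ "ball z r"]) auto
    qed (rule xy)
    moreover have "- (?C \<union> (- D \<union> R)) \<subseteq> - (K \<union> path_image g)" using D C by auto
    ultimately show "connected_component (- (K \<union> path_image g)) x y"
      using connected_component_of_subset by blast
  qed (use r D in auto)
qed

text \<open>The set \<open>S\<close> stands for the inside or the outside of the Jordan curve. By the local statement, the
  component of the complement of \<open>K \<union> g\<close> that is seen on this side of the arc is locally constant
  along the open arc, hence constant.\<close>

lemma crosscut_one_side:
  fixes g h :: "real \<Rightarrow> complex"
  assumes K: "compact K" and g: "arc g" and gK: "path_image g \<inter> K = {pathstart g, pathfinish g}"
    and h: "arc h" "path_image h \<subseteq> K" "pathstart h = pathfinish g" "pathfinish h = pathstart g"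
    and S: "connected S" "S \<subseteq> - path_image (g +++ h)" "frontier S = path_image (g +++ h)"
      "S \<in> components (- path_image (g +++ h))"
  obtains X where "X \<in> components (- (K \<union> path_image g))" "X \<subseteq> S" "path_image g \<subseteq> closure X"
    "\<And>z. z \<in> path_image g - K \<Longrightarrow> \<exists>N. open N \<and> z \<in> N \<and> N \<inter> K = {} \<and> N \<inter> S \<subseteq> X"
proof -
  let ?A = "path_image g - K" and ?W = "- (K \<union> path_image g)"
  have C: "path_image (g +++ h) = path_image g \<union> path_image h"
    using h by (simp add: path_image_join)
  have A: "?A = g ` {0<..<1}" by (rule arc_interior_eq[OF g gK])
  have cont: "continuous_on {0..1} g" using g by (simp add: arc_def path_def)
  have "\<exists>N. open N \<and> z \<in> N \<and> N \<inter> K = {} \<and>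
          (\<forall>x\<in>N \<inter> S. \<forall>y\<in>N \<inter> S. connected_component ?W x y)" if "z \<in> ?A" for z
  proof -
    obtain N where N: "open N" "z \<in> N" "N \<inter> K = {}"
      "\<And>x y. \<lbrakk>x \<in> N; y \<in> N; connected_component (- path_image (g +++ h)) x y\<rbrakk>
       \<Longrightarrow> connected_component ?W x y"
      using crosscut_local_side[OF K g gK h \<open>z \<in> ?A\<close>] by metis
    have "connected_component (- path_image (g +++ h)) x y" if "x \<in> S" "y \<in> S" for x y
      using S that unfolding connected_component_def by blast
    then show ?thesis using N by blast
  qed
  then obtain N where N: "\<And>z. z \<in> ?A \<Longrightarrow> open (N z) \<and> z \<in> N z \<and> N z \<inter> K = {}"
    "\<And>z x y. \<lbrakk>z \<in> ?A; x \<in> N z \<inter> S; y \<in> N z \<inter> S\<rbrakk> \<Longrightarrow> connected_component ?W x y"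
    by metis
  have clS: "z \<in> closure S" if "z \<in> ?A" for z
    using that S(3) C by (auto simp: frontier_def)
  have "g (1/2) \<in> ?A" using A by auto
  then obtain z0 where z0: "z0 \<in> ?A" ..
  obtain x0 where x0: "x0 \<in> N z0 \<inter> S"
    using clS[OF z0] N(1)[OF z0] closure_iff_nhds_not_empty[of z0 S] by blast
  define X where "X = connected_component_set ?W x0"
  have "x0 \<in> ?W" using N(2)[OF z0 x0 x0] by (simp add: connected_component_in)
  then have Xc: "X \<in> components ?W" by (auto simp: X_def components_def)
  have "x0 \<in> X" using \<open>x0 \<in> ?W\<close> by (simp add: X_def)
  have "X \<subseteq> S"
  proof (rule components_maximal[OF S(4)])
    show "connected X" using in_components_connected[OF Xc] .
    show "X \<subseteq> - path_image (g +++ h)" using in_components_subset[OF Xc] C h(2) by blast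
    show "S \<inter> X \<noteq> {}" using x0 \<open>x0 \<in> X\<close> by blast
  qed
  have NX: "N z \<inter> S \<subseteq> X" if z: "z \<in> ?A" "z \<in> closure X" for z
  proof
    fix y assume y: "y \<in> N z \<inter> S"
    obtain x where x: "x \<in> N z" "x \<in> X"
      using z N(1)[OF z(1)] closure_iff_nhds_not_empty[of z X] by blast
    then have "connected_component ?W x y" using N(2)[OF z(1)] y \<open>X \<subseteq> S\<close> by blast
    then show "y \<in> X" using x(2) by (auto simp: X_def intro: connected_component_trans)
  qed
  \<comment> \<open>The points of the open arc that see the component on this side form a clopen subset of the arc.\<close>
  let ?P = "?A \<inter> closure X"
  have "openin (top_of_set ?A) ?P"
  proof -
    have "z' \<in> closure X" if z: "z \<in> ?P" "z' \<in> N z" "z' \<in> ?A" for z z'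
    proof -
      have "z' \<in> N z \<inter> closure S" using clS z by auto
      then have "z' \<in> closure (N z \<inter> S)"
        using N(1)[of z] z open_Int_closure_subset[of "N z" S] by blast
      then show ?thesis using closure_mono[OF NX[of z]] z by auto
    qed
    then have "?P = ?A \<inter> (\<Union>z\<in>?P. N z)" using N(1) by blast
    moreover have "open (\<Union>z\<in>?P. N z)" using N(1) by auto
    ultimately show ?thesis by (metis openin_open)
  qed
  moreover have "closedin (top_of_set ?A) ?P"
    by (simp add: closedin_closed_Int)
  moreover have "connected ?A"
    unfolding A using cont by (intro connected_continuous_image) (auto elim: continuous_on_subset)
  moreover have "z0 \<in> ?P"
  proof -
    have "N z0 \<inter> S \<subseteq> X"
      using N(2)[OF z0 x0] by (auto simp: X_def)
    moreover have "z0 \<in> closure (N z0 \<inter> S)"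
      using N(1)[OF z0] clS[OF z0] open_Int_closure_subset[of "N z0" S] by blast
    ultimately show ?thesis using z0 closure_mono[of "N z0 \<inter> S" X] by auto
  qed
  ultimately have P: "?P = ?A" unfolding connected_clopen by blast
  have "path_image g \<subseteq> closure ?A"
  proof -
    have "path_image g = g ` closure {0<..<1}" by (simp add: path_image_def)
    also have "\<dots> \<subseteq> closure (g ` {0<..<1})"
      using cont by (intro image_closure_subset) (auto simp: closure_subset)
    finally show ?thesis by (simp add: A)
  qed
  also have "\<dots> \<subseteq> closure X" using P closure_minimal[of ?A "closure X"] by auto
  finally have "path_image g \<subseteq> closure X" .
  then show ?thesis
  proof (rule that[OF Xc \<open>X \<subseteq> S\<close>])
    fix z assume z: "z \<in> ?A"
    then have "z \<in> closure X" using P by blast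
    then show "\<exists>N. open N \<and> z \<in> N \<and> N \<inter> K = {} \<and> N \<inter> S \<subseteq> X"
      using NX[OF z] N(1)[OF z] by (intro exI[of _ "N z"]) simp
  qed
qed

text \<open>The final conclusion says that the two components fill the neighbourhood of each interior point of
  the arc. It makes the two components the only ones at the arc, and their union with the open arc
  an open set.\<close>

lemma crosscut_two_sides:
  fixes g :: "real \<Rightarrow> complex"
  assumes K: "compact K" and g: "arc g" and gK: "path_image g \<inter> K = {pathstart g, pathfinish g}"
    and pc: "path_component K (pathstart g) (pathfinish g)"
  obtains X Y where "X \<in> components (- (K \<union> path_image g))" "Y \<in> components (- (K \<union> path_image g))"
    "X \<noteq> Y" "path_image g \<subseteq> frontier X" "path_image g \<subseteq> frontier Y"
    "\<And>z. z \<in> path_image g - K \<Longrightarrow> \<exists>N. open N \<and> z \<in> N \<and> N \<inter> K = {} \<and> N - path_image g \<subseteq> X \<union> Y"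
proof -
  let ?W = "- (K \<union> path_image g)"
  have ne: "pathfinish g \<noteq> pathstart g" using g arc_distinct_ends by fastforce
  obtain p where p: "path p" "path_image p \<subseteq> K" "pathstart p = pathfinish g" "pathfinish p = pathstart g"
    using pc path_component_sym unfolding path_component_def by metis
  obtain h where h: "arc h" "path_image h \<subseteq> K" "pathstart h = pathfinish g" "pathfinish h = pathstart g"
    using path_contains_arc[OF p(1,3,4) ne] p(2) by (metis order_trans)
  define c where "c = g +++ h"
  have c: "simple_path c" "pathfinish c = pathstart c"
    using simple_path_join_loop[of g h] g h gK by (auto simp: c_def)
  have C: "path_image c = path_image g \<union> path_image h"
    using h by (simp add: path_image_join c_def)
  note J = Jordan_inside_outside[OF c]
  have "components (- path_image c) = {inside (path_image c), outside (path_image c)}"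
  proof (rule components_eq_open_partition)
    show "pairwise disjnt {inside (path_image c), outside (path_image c)}"
      using J by (simp add: pairwise_insert disjnt_def Int_commute)
  qed (use J in auto)
  then have S: "inside (path_image c) \<in> components (- path_image c)"
      "outside (path_image c) \<in> components (- path_image c)" by auto
  obtain X where X: "X \<in> components ?W" "X \<subseteq> inside (path_image c)" "path_image g \<subseteq> closure X"
    "\<And>z. z \<in> path_image g - K \<Longrightarrow> \<exists>N. open N \<and> z \<in> N \<and> N \<inter> K = {} \<and> N \<inter> inside (path_image c) \<subseteq> X"
  proof (rule crosscut_one_side[OF K g gK h, of "inside (path_image c)"])
    show "inside (path_image c) \<subseteq> - path_image (g +++ h)"
      using inside_no_overlap[of "path_image c"] unfolding c_def by blast
  qed (use J S that in \<open>auto simp: c_def\<close>)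
  obtain Y where Y: "Y \<in> components ?W" "Y \<subseteq> outside (path_image c)" "path_image g \<subseteq> closure Y"
    "\<And>z. z \<in> path_image g - K \<Longrightarrow> \<exists>N. open N \<and> z \<in> N \<and> N \<inter> K = {} \<and> N \<inter> outside (path_image c) \<subseteq> Y"
  proof (rule crosscut_one_side[OF K g gK h, of "outside (path_image c)"])
    show "outside (path_image c) \<subseteq> - path_image (g +++ h)"
      using outside_no_overlap[of "path_image c"] unfolding c_def by blast
  qed (use J S that in \<open>auto simp: c_def\<close>)
  have opW: "open ?W" using K g
    by (intro open_Compl closed_Un) (simp_all add: compact_imp_closed closed_arc_image)
  have fr: "path_image g \<subseteq> frontier Z" if "Z \<in> components ?W" "path_image g \<subseteq> closure Z" for Z
  proof -
    have "open Z" using opW that open_components by blast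
    then show ?thesis using that in_components_subset[OF that(1)] by (auto simp: frontier_def interior_open)
  qed
  have "X \<inter> Y = {}"
    using X(2) Y(2) inside_Int_outside[of "path_image c"] by blast
  then have "X \<noteq> Y" using in_components_nonempty[OF X(1)] by blast
  moreover have "\<exists>N. open N \<and> z \<in> N \<and> N \<inter> K = {} \<and> N - path_image g \<subseteq> X \<union> Y"
    if z: "z \<in> path_image g - K" for z
  proof -
    obtain M where M: "open M" "z \<in> M" "M \<inter> K = {}" "M \<inter> inside (path_image c) \<subseteq> X"
      using X(4)[OF z] by blast
    obtain N where N: "open N" "z \<in> N" "N \<inter> outside (path_image c) \<subseteq> Y"
      using Y(4)[OF z] by blast
    have "M \<inter> N - path_image g \<subseteq> - path_image c" using M C h(2) by auto
    then have "M \<inter> N - path_image g \<subseteq> inside (path_image c) \<union> outside (path_image c)"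
      by simp
    then have "M \<inter> N - path_image g \<subseteq> X \<union> Y" using M(4) N(3) by blast
    then show ?thesis using M(1-3) N(1,2) by (intro exI[of _ "M \<inter> N"]) auto
  qed
  ultimately show ?thesis
    using that[OF X(1) Y(1)] fr[OF X(1) X(3)] fr[OF Y(1) Y(3)] by simp
qed

lemma card_components_crosscut_frontier:
  fixes g :: "real \<Rightarrow> complex"
  assumes "compact K" "arc g" and gK: "path_image g \<inter> K = {pathstart g, pathfinish g}"
    and "path_component K (pathstart g) (pathfinish g)"
  shows "card {Z \<in> components (- (K \<union> path_image g)). path_image g \<subseteq> frontier Z} = 2"
proof -
  obtain X Y where XY: "X \<in> components (- (K \<union> path_image g))" "Y \<in> components (- (K \<union> path_image g))"
    "X \<noteq> Y" "path_image g \<subseteq> frontier X" "path_image g \<subseteq> frontier Y"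
    "\<And>z. z \<in> path_image g - K \<Longrightarrow> \<exists>N. open N \<and> z \<in> N \<and> N \<inter> K = {} \<and> N - path_image g \<subseteq> X \<union> Y"
    using crosscut_two_sides[OF assms] by metis
  have "Z \<in> {X, Y}" if Z: "Z \<in> components (- (K \<union> path_image g))" "path_image g \<subseteq> frontier Z" for Z
  proof -
    have "g (1/2) \<in> path_image g - K"
      using arc_interior_eq[OF assms(2) gK] by auto
    then obtain z where z: "z \<in> path_image g - K" ..
    then obtain N where N: "open N" "z \<in> N" "N - path_image g \<subseteq> X \<union> Y" using XY(6) by blast
    have "z \<in> closure Z" using z Z by (auto simp: frontier_def)
    then obtain w where "w \<in> N" "w \<in> Z" using N closure_iff_nhds_not_empty[of z Z] by blast
    then have "w \<in> X \<union> Y" using N in_components_subset[OF Z(1)] by auto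
    then show ?thesis using components_eq[OF Z(1)] XY(1,2) \<open>w \<in> Z\<close> by blast
  qed
  then have "{Z \<in> components (- (K \<union> path_image g)). path_image g \<subseteq> frontier Z} = {X, Y}"
    using XY(1,2,4,5) by blast
  then show ?thesis using XY(3) by simp
qed

lemma card_components_crosscut:
  fixes g :: "real \<Rightarrow> complex"
  assumes K: "compact K" and g: "arc g" and gK: "path_image g \<inter> K = {pathstart g, pathfinish g}"
    and pc: "path_component K (pathstart g) (pathfinish g)" and fin: "finite (components (- K))"
  shows "finite (components (- (K \<union> path_image g)))"
    and "card (components (- (K \<union> path_image g))) = Suc (card (components (- K)))"
proof -
  let ?W = "- (K \<union> path_image g)" and ?A = "path_image g - K"
  obtain X Y where XY: "X \<in> components ?W" "Y \<in> components ?W"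
    "X \<noteq> Y" "path_image g \<subseteq> frontier X" "path_image g \<subseteq> frontier Y"
    and N: "\<And>z. z \<in> ?A \<Longrightarrow> \<exists>N. open N \<and> z \<in> N \<and> N \<inter> K = {} \<and> N - path_image g \<subseteq> X \<union> Y"
    using crosscut_two_sides[OF K g gK pc] by metis
  define U where "U = X \<union> Y \<union> ?A"
  have opW: "open ?W" using K g
    by (intro open_Compl closed_Un) (simp_all add: compact_imp_closed closed_arc_image)
  have op: "open Z" if "Z \<in> components ?W" for Z using opW that open_components by blast
  have Ane: "?A \<noteq> {}" using arc_interior_eq[OF g gK] by auto
  have "open U"
    unfolding open_subopen[of U]
  proof
    fix z assume "z \<in> U"
    then consider "z \<in> X" | "z \<in> Y" | "z \<in> ?A" by (auto simp: U_def)
    then show "\<exists>T. open T \<and> z \<in> T \<and> T \<subseteq> U"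
    proof cases
      case 3 then show ?thesis using N[OF 3] unfolding U_def by blast
    qed (use op XY in \<open>auto simp: U_def\<close>)
  qed
  have con: "connected (Z \<union> ?A)" if "Z \<in> components ?W" "path_image g \<subseteq> frontier Z" for Z
  proof (rule connected_intermediate_closure)
    show "connected Z" using in_components_connected[OF that(1)] .
    show "Z \<union> ?A \<subseteq> closure Z" using that(2) closure_subset[of Z] by (auto simp: frontier_def)
  qed blast
  have "connected (X \<union> ?A)" "connected (Y \<union> ?A)" using con XY(1,2,4,5) by blast+
  then have "connected ((X \<union> ?A) \<union> (Y \<union> ?A))" by (rule connected_Un) (use Ane in auto)
  moreover have "(X \<union> ?A) \<union> (Y \<union> ?A) = U" by (auto simp: U_def)
  ultimately have "connected U" by simp
  have disjU: "Z \<inter> U = {}" if "Z \<in> components ?W - {X, Y}" for Z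
  proof -
    have "Z \<inter> X = {}" "Z \<inter> Y = {}" "Z \<inter> ?A = {}"
      using that components_eq[of Z ?W X] components_eq[of Z ?W Y] XY(1,2) in_components_subset[of Z ?W]
      by blast+
    then show ?thesis unfolding U_def by blast
  qed
  have comps: "components (- K) = insert U (components ?W - {X, Y})"
  proof (rule components_eq_open_partition)
    have "\<Union>(insert U (components ?W - {X, Y})) = \<Union>(components ?W) \<union> ?A"
      using XY(1,2) unfolding U_def by blast
    also have "\<dots> = - K" using gK by auto
    finally show "\<Union>(insert U (components ?W - {X, Y})) = - K" .
    show "pairwise disjnt (insert U (components ?W - {X, Y}))"
      using disjU pairwise_subset[OF pairwise_disjoint_components, of "components ?W - {X, Y}" ?W]
      unfolding pairwise_insert disjnt_def by (simp add: Int_commute)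
    show "\<And>Z. Z \<in> insert U (components ?W - {X, Y}) \<Longrightarrow> open Z \<and> connected Z \<and> Z \<noteq> {}"
      using \<open>open U\<close> \<open>connected U\<close> Ane op in_components_connected in_components_nonempty
      unfolding U_def by blast
  qed
  have "U \<notin> components ?W - {X, Y}"
    using disjU[of U] Ane unfolding U_def by blast
  moreover have "finite (components ?W - {X, Y})" using fin comps by simp
  ultimately have "card (components (- K)) = Suc (card (components ?W - {X, Y}))"
    using comps by simp
  moreover show fW: "finite (components ?W)"
    using \<open>finite (components ?W - {X, Y})\<close> by simp
  moreover have "card (components ?W - {X, Y}) = card (components ?W) - 2" "2 \<le> card (components ?W)"
    using XY(1,2,3) fW card_Diff_subset[of "{X,Y}" "components ?W"] card_mono[of "components ?W" "{X,Y}"]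
    by auto
  ultimately show "card (components ?W) = Suc (card (components (- K)))" by linarith
qed

text \<open>This is Janiszewski's theorem together with the fact that an arc does not separate the plane. It is
  used for arcs that meet \<open>K\<close> in one end, that is, for new leaves of a tree.\<close>

lemma connected_Compl_Un_arc:
  fixes g :: "real \<Rightarrow> complex"
  assumes K: "compact K" and "connected (- K)" and g: "arc g" and "connected (path_image g \<inter> K)"
  shows "connected (- (K \<union> path_image g))"
  unfolding connected_iff_connected_component
proof (intro ballI)
  fix x y assume xy: "x \<in> - (K \<union> path_image g)" "y \<in> - (K \<union> path_image g)"
  have "connected (- path_image g)" using connected_arc_complement[OF g] by simp
  then have "connected_component (- (path_image g \<union> K)) x y"
    using assms xy
    by (intro Janiszewski) (auto simp: compact_arc_image compact_imp_closed connected_iff_connected_component)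
  then show "connected_component (- (K \<union> path_image g)) x y" by (simp add: Un_commute)
qed

section \<open>Edges and faces of a plane graph\<close>

lemma plane_graphD:
  assumes "plane_graph V E pos curve"
  shows "simple_graph V E" "inj_on pos V"
    "\<And>e. e \<in> E \<Longrightarrow> arc (curve e)"
    "\<And>e. e \<in> E \<Longrightarrow> {pathstart (curve e), pathfinish (curve e)} = pos ` e"
    "\<And>e v. \<lbrakk>e \<in> E; v \<in> V; pos v \<in> path_image (curve e)\<rbrakk> \<Longrightarrow> v \<in> e"
    "\<And>e e'. \<lbrakk>e \<in> E; e' \<in> E; e \<noteq> e'\<rbrakk> \<Longrightarrow> path_image (curve e) \<inter> path_image (curve e') \<subseteq> pos ` (e \<inter> e')"
    "\<And>e. e \<in> E \<Longrightarrow> e \<subseteq> V"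
proof -
  show G: "simple_graph V E" using assms by (simp add: plane_graph_def)
  show "\<And>e. e \<in> E \<Longrightarrow> e \<subseteq> V" using G by (simp add: simple_graph_def)
qed (use assms in \<open>simp_all add: plane_graph_def\<close>)

lemma plane_graph_subgraph:
  assumes "plane_graph V E pos curve" "W \<subseteq> V" "T \<subseteq> E" "\<Union>T \<subseteq> W"
  shows "plane_graph W T pos curve"
proof -
  note P = plane_graphD[OF assms(1)]
  have V: "finite V" "\<And>e. e \<in> E \<Longrightarrow> card e = 2" using P(1) by (auto simp: simple_graph_def)
  have T: "e \<in> E" if "e \<in> T" for e using that assms(3) by blast
  have W: "v \<in> V" if "v \<in> W" for v using that assms(2) by blast
  have "simple_graph W T"
    unfolding simple_graph_def using V T assms(4) finite_subset[OF assms(2)] by auto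
  moreover have "inj_on pos W" using P(2) assms(2) by (rule inj_on_subset)
  ultimately show ?thesis
    unfolding plane_graph_def using P(3-6) T W by simp
qed

lemma compact_drawing:
  assumes "plane_graph V E pos curve"
  shows "compact (drawing V E pos curve)"
proof -
  note P = plane_graphD[OF assms]
  have "finite V" using P(1) by (simp add: simple_graph_def)
  moreover have "finite E" using P(1) by (rule simple_graph_finite_edges)
  ultimately show ?thesis
    unfolding drawing_def using P(3)
    by (intro compact_Un compact_UN) (auto simp: compact_arc_image finite_imp_compact)
qed

lemma drawing_insert_edge:
  "drawing V (insert e E) pos curve = drawing V E pos curve \<union> path_image (curve e)"
  by (auto simp: drawing_def)

lemma endpoints_in_path_image:
  assumes "{pathstart g, pathfinish g} = pos ` e"
  shows "pos ` e \<subseteq> path_image g"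
  using assms[symmetric] by auto

text \<open>Hence an edge whose ends are joined by other edges is a crosscut of the drawing of those edges; the
  closed curve needed above is found topologically instead of from a cycle of the graph.\<close>

lemma joined_imp_path_component:
  assumes P: "plane_graph V E pos curve" and "joined E u v" "u \<in> V"
  shows "path_component (drawing V E pos curve) (pos u) (pos v)"
proof -
  have "(u, v) \<in> {(x, y). {x, y} \<in> E}\<^sup>*" using assms by (simp add: joined_def)
  then show ?thesis
  proof (induction rule: rtrancl_induct)
    case base
    then show ?case using assms(3) by (auto simp: drawing_def path_component_refl_eq)
  next
    case (step x y)
    then have e: "{x, y} \<in> E" by simp
    have "path_connected (path_image (curve {x, y}))"
      using plane_graphD(3)[OF P e] by (simp add: arc_imp_path path_connected_path_image)
    moreover have "pos ` {x, y} \<subseteq> path_image (curve {x, y})"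
      by (rule endpoints_in_path_image[OF plane_graphD(4)[OF P e]])
    ultimately have "path_component (path_image (curve {x, y})) (pos x) (pos y)"
      by (auto simp: path_connected_component)
    moreover have "path_image (curve {x, y}) \<subseteq> drawing V E pos curve"
      using e by (auto simp: drawing_def)
    ultimately show ?case
      using step.IH path_component_of_subset path_component_trans by metis
  qed
qed

lemma edge_is_crosscut:
  assumes P: "plane_graph V (insert e T) pos curve" and "e \<notin> T"
    and "\<forall>u\<in>e. \<forall>v\<in>e. joined T u v"
  shows "compact (drawing V T pos curve)" "arc (curve e)"
    "path_image (curve e) \<inter> drawing V T pos curve = {pathstart (curve e), pathfinish (curve e)}"
    "path_component (drawing V T pos curve) (pathstart (curve e)) (pathfinish (curve e))"
proof -
  note D = plane_graphD[OF P]
  have ends: "{pathstart (curve e), pathfinish (curve e)} = pos ` e" using D(4) by simp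
  have eV: "e \<subseteq> V" using D(7) by simp
  have PT: "plane_graph V T pos curve"
    by (rule plane_graph_subgraph[OF P]) (use D(7) in auto)
  show "compact (drawing V T pos curve)" using compact_drawing[OF PT] .
  show "arc (curve e)" using D(3) by simp
  have "path_image (curve e) \<inter> drawing V T pos curve \<subseteq> pos ` e"
  proof
    fix z assume z: "z \<in> path_image (curve e) \<inter> drawing V T pos curve"
    then consider v where "v \<in> V" "z = pos v" | e' where "e' \<in> T" "z \<in> path_image (curve e')"
      by (auto simp: drawing_def)
    then show "z \<in> pos ` e"
    proof cases
      case 1 then show ?thesis using D(5)[of e v] z by auto
    next
      case 2 then show ?thesis using D(6)[of e e'] z assms(2) by blast
    qed
  qed
  moreover have "pos ` e \<subseteq> path_image (curve e)"
    by (rule endpoints_in_path_image[OF ends])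
  moreover have "pos ` e \<subseteq> drawing V T pos curve" using eV by (auto simp: drawing_def)
  ultimately show "path_image (curve e) \<inter> drawing V T pos curve = {pathstart (curve e), pathfinish (curve e)}"
    unfolding ends by (intro equalityI Int_greatest)
  have "pathstart (curve e) \<in> pos ` e" "pathfinish (curve e) \<in> pos ` e"
    unfolding ends[symmetric] by simp_all
  then obtain u v where uv: "u \<in> e" "v \<in> e"
    "pathstart (curve e) = pos u" "pathfinish (curve e) = pos v"
    by blast
  have "joined T u v" "u \<in> V" using assms(3) uv eV by blast+
  then show "path_component (drawing V T pos curve) (pathstart (curve e)) (pathfinish (curve e))"
    unfolding uv by (rule joined_imp_path_component[OF PT])
qed

lemma card_faces_insert_edge:
  assumes "plane_graph V (insert e T) pos curve" "e \<notin> T"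
    "\<forall>u\<in>e. \<forall>v\<in>e. joined T u v" "finite (faces V T pos curve)"
  shows "finite (faces V (insert e T) pos curve)"
    "card (faces V (insert e T) pos curve) = Suc (card (faces V T pos curve))"
proof -
  note cross = edge_is_crosscut[OF assms(1-3)]
  note card = card_components_crosscut[OF cross assms(4)[unfolded faces_def]]
  show "finite (faces V (insert e T) pos curve)"
    unfolding faces_def drawing_insert_edge by (rule card(1))
  show "card (faces V (insert e T) pos curve) = Suc (card (faces V T pos curve))"
    unfolding faces_def drawing_insert_edge by (rule card(2))
qed

lemma two_faces_per_edge:
  assumes P: "plane_graph V E pos curve" and "e \<in> E" "\<not> cut_edge E e"
  shows "card {F \<in> faces V E pos curve. path_image (curve e) \<subseteq> frontier F} = 2"
proof -
  let ?T = "E - {e}"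
  have E: "insert e ?T = E" using assms(2) by (rule insert_Diff)
  have J: "\<forall>u\<in>e. \<forall>v\<in>e. joined ?T u v"
    using assms(2,3) by (simp add: cut_edge_def)
  have P': "plane_graph V (insert e ?T) pos curve" using P E by simp
  have "e \<notin> ?T" by simp
  note cross = edge_is_crosscut[OF P' this J]
  have "drawing V E pos curve = drawing V ?T pos curve \<union> path_image (curve e)"
    using drawing_insert_edge[of V e ?T] E by simp
  then show ?thesis
    using card_components_crosscut_frontier[OF cross] by (simp only: faces_def)
qed

text \<open>A tree in \<open>E\<close> with \<open>k\<close> edges grows by one edge leaving its vertex set, whose drawing meets
  the old one in a single point, so that the complement stays connected.\<close>

lemma exists_connected_plane_subgraph:
  assumes P: "plane_graph V E pos curve" and con: "\<And>u v. u \<in> V \<Longrightarrow> v \<in> V \<Longrightarrow> joined E u v"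
    and "k < card V"
  shows "\<exists>W T. W \<subseteq> V \<and> card W = Suc k \<and> T \<subseteq> E \<and> card T = k \<and> \<Union>T \<subseteq> W \<and>
     (\<forall>u\<in>W. \<forall>v\<in>W. joined T u v) \<and> connected (- drawing W T pos curve)"
  using assms(3)
proof (induction k)
  case 0
  then have "V \<noteq> {}" by auto
  then obtain v where "v \<in> V" by blast
  moreover have "connected (- {pos v})"
    by (rule connected_punctured_universe) simp
  ultimately show ?case
    by (intro exI[of _ "{v}"] exI[of _ "{}"]) (simp add: drawing_def)
next
  case (Suc k)
  note D = plane_graphD[OF P]
  obtain W T where WT: "W \<subseteq> V" "card W = Suc k" "T \<subseteq> E" "card T = k" "\<Union>T \<subseteq> W"
    "\<And>u v. u \<in> W \<Longrightarrow> v \<in> W \<Longrightarrow> joined T u v" "connected (- drawing W T pos curve)"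
    using Suc.IH Suc.prems by auto
  have "W \<noteq> V" using WT(2) Suc.prems by auto
  then obtain b where b: "b \<in> V" "b \<notin> W" using WT(1) by blast
  obtain a where a: "a \<in> W" using WT(2) by fastforce
  obtain u w where uw: "u \<in> W" "w \<notin> W" "{u, w} \<in> E"
    using joined_exit[OF con[of a b] a b(2)] a b WT(1) by blast
  have w: "w \<in> V" using D(7)[OF uw(3)] by simp
  let ?e = "{u, w}" and ?K = "drawing W T pos curve"
  have eT: "?e \<notin> T" using WT(5) uw(2) by auto
  have PT: "plane_graph W T pos curve" by (rule plane_graph_subgraph[OF P WT(1,3,5)])
  have fin: "finite W" "finite T"
    using plane_graphD(1)[OF PT] simple_graph_finite_edges by (auto simp: simple_graph_def)
  have ends: "pos ` ?e \<subseteq> path_image (curve ?e)"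
    by (rule endpoints_in_path_image[OF D(4)[OF uw(3)]])
  have "path_image (curve ?e) \<inter> ?K \<subseteq> {pos u}"
  proof
    fix z assume z: "z \<in> path_image (curve ?e) \<inter> ?K"
    then consider v where "v \<in> W" "z = pos v" | e' where "e' \<in> T" "z \<in> path_image (curve e')"
      by (auto simp: drawing_def)
    then show "z \<in> {pos u}"
    proof cases
      case 1
      then have "v \<in> ?e" using D(5)[OF uw(3), of v] z WT(1) by auto
      then show ?thesis using 1 uw(2) by auto
    next
      case 2
      then have "z \<in> pos ` (?e \<inter> e')" using D(6)[OF uw(3), of e'] z WT(3) eT by blast
      moreover have "e' \<subseteq> W" using 2 WT(5) by auto
      ultimately show ?thesis using uw(2) by auto
    qed
  qed
  moreover have "pos u \<in> ?K" using uw(1) by (simp add: drawing_def)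
  ultimately have int: "path_image (curve ?e) \<inter> ?K = {pos u}" using ends by auto
  have "connected (- (?K \<union> path_image (curve ?e)))"
    using connected_Compl_Un_arc[OF compact_drawing[OF PT] WT(7) D(3)[OF uw(3)]] int by simp
  moreover have "drawing (insert w W) (insert ?e T) pos curve = ?K \<union> path_image (curve ?e)"
    using ends by (auto simp: drawing_def)
  moreover have "joined (insert ?e T) x y" if "x \<in> insert w W" "y \<in> insert w W" for x y
  proof -
    have "joined (insert ?e T) u z" if "z \<in> insert w W" for z
    proof (cases "z = w")
      case True then show ?thesis by (simp add: joined_edge)
    next
      case False
      then have "joined T u z" using WT(6) uw(1) that by auto
      then show ?thesis by (rule joined_mono) auto
    qed
    then show ?thesis using that joined_sym joined_trans by metis
  qed
  ultimately show ?case
    using WT fin uw w eT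
    by (intro exI[of _ "insert w W"] exI[of _ "insert ?e T"]) auto
qed

text \<open>The formula holds for a spanning tree, which has one face; every further edge is a crosscut and
  adds one face.\<close>

theorem euler_formula:
  assumes P: "plane_graph V E pos curve" and "V \<noteq> {}"
    and con: "\<And>u v. u \<in> V \<Longrightarrow> v \<in> V \<Longrightarrow> joined E u v"
  shows "finite (faces V E pos curve)" "card V + card (faces V E pos curve) = card E + 2"
proof -
  note D = plane_graphD[OF P]
  have finV: "finite V" using D(1) by (simp add: simple_graph_def)
  have finE: "finite E" using D(1) by (rule simple_graph_finite_edges)
  have n: "0 < card V" using assms(2) finV by (simp add: card_gt_0_iff)
  then obtain W T where WT: "W \<subseteq> V" "card W = card V" "T \<subseteq> E" "Suc (card T) = card V"
    "\<And>u v. u \<in> W \<Longrightarrow> v \<in> W \<Longrightarrow> joined T u v" "connected (- drawing W T pos curve)"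
    using exists_connected_plane_subgraph[OF P con, of "card V - 1"] by auto
  have "W = V" using WT(1,2) finV card_subset_eq by blast
  have "- drawing V T pos curve \<noteq> {}"
  proof -
    have "plane_graph V T pos curve"
      by (rule plane_graph_subgraph[OF P _ WT(3)]) (use D(7) WT(3) in auto)
    then have "compact (drawing V T pos curve)" by (rule compact_drawing)
    then have "drawing V T pos curve \<noteq> UNIV" using not_compact_UNIV by metis
    then show ?thesis by blast
  qed
  then have F0: "faces V T pos curve = {- drawing V T pos curve}"
    using WT(6) \<open>W = V\<close> by (simp add: faces_def components_eq_sing_iff)
  have "finite (faces V (T \<union> S) pos curve) \<and>
      card V + card (faces V (T \<union> S) pos curve) = card (T \<union> S) + 2"
    if "finite S" "S \<subseteq> E - T" for S
    using that
  proof (induction S rule: finite_induct)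
    case empty
    then show ?case using F0 WT(4) by simp
  next
    case (insert e S)
    let ?T = "T \<union> S"
    have PT: "plane_graph V (insert e ?T) pos curve"
      by (rule plane_graph_subgraph[OF P]) (use insert.prems WT(3) D(7) in auto)
    have eT: "e \<notin> ?T" using insert by auto
    have "\<forall>u\<in>e. \<forall>v\<in>e. joined ?T u v"
    proof (intro ballI)
      fix u v assume uv: "u \<in> e" "v \<in> e"
      have "e \<in> E" using insert.prems by simp
      then have "joined T u v" using WT(5) \<open>W = V\<close> D(7) uv by blast
      then show "joined ?T u v" by (rule joined_mono) auto
    qed
    note step = card_faces_insert_edge[OF PT eT this]
    have "finite ?T" using finE WT(3) insert.hyps finite_subset by blast
    then show ?case using step insert eT by auto
  qed
  from this[of "E - T"] finE WT(3)
  show "finite (faces V E pos curve)" "card V + card (faces V E pos curve) = card E + 2"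
    by (simp_all add: Un_absorb1)
qed

section \<open>Graphs without star-cutsets\<close>

lemma joined_off_vertex:
  assumes "\<not> (\<exists>S. star_cutset V E S)" "x \<in> V" "u \<in> V - {x}" "v \<in> V - {x}"
  shows "joined {e \<in> E. e \<subseteq> V - {x}} u v"
proof (rule ccontr)
  assume "\<not> ?thesis"
  then have "star_cutset V E {x}"
    using assms(2-) unfolding star_cutset_def separating_set_def disconnected_graph_def by blast
  then show False using assms(1) by blast
qed

text \<open>The closed neighbourhood of \<open>x\<close> is a star-cutset as soon as it separates.\<close>

lemma joined_off_neighbourhood:
  assumes "simple_graph V E" "\<not> (\<exists>S. star_cutset V E S)" "x \<in> V"
    and "u \<in> V - {x}" "{x, u} \<notin> E" "v \<in> V - {x}" "{x, v} \<notin> E"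
  shows "joined {e \<in> E. e \<subseteq> V - insert x {y. {x, y} \<in> E}} u v"
proof (rule ccontr)
  let ?S = "insert x {y. {x, y} \<in> E}"
  assume "\<not> ?thesis"
  then have "star_cutset V E ?S"
    using assms simple_graph_edgeD[OF assms(1)]
    unfolding star_cutset_def separating_set_def disconnected_graph_def by blast
  then show False using assms(2) by blast
qed

text \<open>An end \<open>a\<close> of an edge \<open>ab\<close> reaches every vertex: deleting \<open>a\<close> leaves \<open>b\<close> joined to all other
  vertices.\<close>

lemma joined_if_no_star_cutset:
  assumes "simple_graph V E" "\<not> (\<exists>S. star_cutset V E S)" "E \<noteq> {}" "u \<in> V" "v \<in> V"
  shows "joined E u v"
proof -
  obtain e where "e \<in> E" using assms(3) by blast
  then have "e \<noteq> {}" using assms(1) by (auto simp: simple_graph_def)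
  then obtain a where "a \<in> e" by blast
  obtain b where "e = {a, b}" using simple_graph_edgeE[OF assms(1) \<open>e \<in> E\<close> \<open>a \<in> e\<close>] by blast
  then have ab: "{a, b} \<in> E" using \<open>e \<in> E\<close> by simp
  have "joined E a w" if "w \<in> V" for w
  proof (cases "w = a")
    case False
    then have "joined {e \<in> E. e \<subseteq> V - {a}} b w"
      using joined_off_vertex[OF assms(2)] simple_graph_edgeD[OF assms(1) ab] that by auto
    then have "joined E b w" by (rule joined_mono) auto
    then show ?thesis using joined_edge[OF ab] joined_trans by metis
  qed simp
  then show ?thesis using assms joined_sym joined_trans by metis
qed

lemma third_vertex:
  assumes "3 \<le> card V"
  obtains z where "z \<in> V" "z \<noteq> a" "z \<noteq> b"
proof -
  have "card {a, b} \<le> 2" by (simp add: card_insert_le_m1)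
  then have "\<not> V \<subseteq> {a, b}" using assms card_mono[of "{a, b}" V] by auto
  then show ?thesis using that by auto
qed

text \<open>If \<open>z\<close> is a third vertex, then \<open>u\<close> reaches \<open>z\<close> in the graph without \<open>v\<close>, and \<open>z\<close> reaches \<open>v\<close> in
  the graph without \<open>u\<close>; neither walk uses the edge \<open>uv\<close>.\<close>

lemma no_cut_edge_if_no_star_cutset:
  assumes G: "simple_graph V E" and S: "\<not> (\<exists>S. star_cutset V E S)" and "3 \<le> card V"
  shows "\<not> cut_edge E e"
proof
  assume "cut_edge E e"
  then obtain u v where uv: "e \<in> E" "u \<in> e" "v \<in> e" "\<not> joined (E - {e}) u v"
    by (auto simp: cut_edge_def)
  have "u \<noteq> v" using uv by auto
  then have e: "e = {u, v}" using simple_graph_edgeE[OF G uv(1,2)] uv(3) by blast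
  have V: "u \<in> V" "v \<in> V" using simple_graph_edgeD[OF G] uv(1) e by auto
  obtain z where z: "z \<in> V" "z \<noteq> u" "z \<noteq> v" using third_vertex[OF assms(3)] .
  have "joined {e \<in> E. e \<subseteq> V - {v}} u z" "joined {e \<in> E. e \<subseteq> V - {u}} z v"
    using joined_off_vertex[OF S] V z \<open>u \<noteq> v\<close> by auto
  then have "joined (E - {e}) u z" "joined (E - {e}) z v"
    using e by (auto elim!: joined_mono)
  then show False using uv(4) joined_trans by metis
qed

text \<open>In the graph without a neighbour \<open>y\<close> of \<open>x\<close>, the vertex \<open>x\<close> is still joined to
  a third vertex. The conclusion is stated for arbitrary \<open>y\<close>, as the existence of a neighbour that
  differs from a given vertex is what the constructions below need.\<close>

lemma another_neighbour_if_no_star_cutset: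
  assumes G: "simple_graph V E" and S: "\<not> (\<exists>S. star_cutset V E S)" and "3 \<le> card V"
    and "E \<noteq> {}" "x \<in> V"
  obtains y' where "{x, y'} \<in> E" "y' \<noteq> y"
proof -
  have *: "\<exists>y'. {x, y'} \<in> E \<and> y' \<noteq> y" if "y \<in> V - {x}" for y
  proof -
    obtain z where z: "z \<in> V" "z \<noteq> x" "z \<noteq> y" using third_vertex[OF assms(3)] .
    then have "joined {e \<in> E. e \<subseteq> V - {y}} x z"
      using joined_off_vertex[OF S] that assms by auto
    then obtain a b where "a \<in> {x}" "b \<notin> {x}" "{a, b} \<in> {e \<in> E. e \<subseteq> V - {y}}"
      using joined_exit[of _ x z "{x}"] z by blast
    then show ?thesis by auto
  qed
  show ?thesis
  proof (cases "y \<in> V - {x}")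
    case True then show ?thesis using * that by blast
  next
    case False
    obtain z where "z \<in> V" "z \<noteq> x" using third_vertex[OF assms(3)] by metis
    then obtain y' where "{x, y'} \<in> E" using *[of z] by blast
    moreover have "y' \<in> V - {x}" using simple_graph_edgeD[OF G] calculation by fastforce
    ultimately show ?thesis using that False by metis
  qed
qed

section \<open>The lower bound on overlap representations\<close>

text \<open>Containment in \<open>f x\<close> spreads along an edge \<open>ab\<close> of non-neighbours of \<open>x\<close>: the set \<open>f b\<close> overlaps
  \<open>f a\<close>, hence meets \<open>f x\<close>, does not overlap it, and cannot contain it, for then it would contain
  \<open>f a\<close>.\<close>

lemma contained_in_all_nonneighbours:
  assumes G: "simple_graph V E" and S: "\<not> (\<exists>S. star_cutset V E S)"
    and f: "overlap_representation V E f" and x: "x \<in> V"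
    and z: "z \<in> V - {x}" "{x, z} \<notin> E" "f z \<subseteq> f x"
    and w: "w \<in> V - {x}" "{x, w} \<notin> E"
  shows "f w \<subseteq> f x"
proof -
  let ?E = "{e \<in> E. e \<subseteq> V - insert x {y. {x, y} \<in> E}}"
  have "(z, w) \<in> {(a, b). {a, b} \<in> ?E}\<^sup>*"
    using joined_off_neighbourhood[OF G S x z(1,2) w] by (simp add: joined_def)
  then show ?thesis
  proof (induction rule: rtrancl_induct)
    case base show ?case by (rule z(3))
  next
    case (step a b)
    then have ab: "{a, b} \<in> E" "a \<in> V" "b \<in> V" "b \<noteq> x" "{x, b} \<notin> E" by auto
    then have "overlap (f a) (f b)" "\<not> overlap (f x) (f b)"
      using f x simple_graph_edgeD(3)[OF G ab(1)] unfolding overlap_representation_def by auto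
    with step.IH show ?case unfolding overlap_def by blast
  qed
qed

text \<open>In the main case the big vertices are pairwise adjacent, and each edge with an end that is not big
  receives an element: for an edge with both ends not big, one that the two sets share; for an edge
  from a big \<open>x\<close> to another vertex \<open>y\<close>, one of \<open>f y - f x\<close>. The predicate \<open>Q\<close> describes both kinds
  at once. An element that serves an edge with an end \<open>a\<close> that is not big and lies in the set of
  another vertex \<open>c\<close> that is not big determines the edge as \<open>ac\<close>, since the other end of the edge
  cannot be adjacent to both \<open>a\<close> and \<open>c\<close>.

  If two big vertices are not adjacent, their sets contain each other, so they are twins. As the
  closed neighbourhood of one does not separate the other from the remaining vertices, all of
  these are common neighbours; and three common neighbours are impossible, because deleting the
  closed neighbourhood of the first would isolate the second.\<close>

lemma card_edges_le_size:
  fixes f :: "'a \<Rightarrow> 'b set"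
  assumes G: "simple_graph V E" and tri: "triangle_free E" and S: "\<not> (\<exists>S. star_cutset V E S)"
    and f: "overlap_representation V E f" and fin: "\<forall>v\<in>V. finite (f v)"
  shows "card E \<le> Suc (representation_size V f)"
proof -
  \<comment> \<open>By the previous lemma, the sets of these vertices, called big below, contain the sets of all their non-neighbours.\<close>
  define B where "B = {x \<in> V. \<exists>z\<in>V - {x}. {x, z} \<notin> E \<and> f z \<subseteq> f x}"
  let ?U = "\<Union>v\<in>V. f v"
  have finV: "finite V" using G by (simp add: simple_graph_def)
  have finU: "finite ?U" using finV fin by simp
  have finE: "finite E" using G by (rule simple_graph_finite_edges)
  note ED = simple_graph_edgeD[OF G]
  have B: "f w \<subseteq> f x" if "x \<in> B" "w \<in> V" "w \<noteq> x" "{x, w} \<notin> E" for x w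
    using that contained_in_all_nonneighbours[OF G S f, of x _ w] unfolding B_def by blast
  have ov: "overlap (f a) (f b) \<longleftrightarrow> {a, b} \<in> E" if "a \<in> V" "b \<in> V" "a \<noteq> b" for a b
    using f that by (simp add: overlap_representation_def)
  have nonB: "{a, c} \<in> E" if "a \<in> V - B" "c \<in> V - B" "a \<noteq> c" "s \<in> f a" "s \<in> f c" for a c s
  proof (rule ccontr)
    assume n: "{a, c} \<notin> E"
    then have "f a \<subseteq> f c \<or> f c \<subseteq> f a" using ov[of a c] that by (auto simp: overlap_def)
    then show False using that n unfolding B_def by (auto simp: insert_commute)
  qed
  show ?thesis
  proof (cases "\<forall>x\<in>B. \<forall>y\<in>B. x \<noteq> y \<longrightarrow> {x, y} \<in> E")
    case True
    define Q where "Q e s \<longleftrightarrow> (\<forall>y\<in>e - B. s \<in> f y) \<and> (\<forall>x\<in>e \<inter> B. s \<notin> f x)" for e s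
    let ?E1 = "{e \<in> E. \<not> e \<subseteq> B}"
    have "\<exists>s\<in>?U. Q e s" if e: "e \<in> ?E1" for e
    proof -
      obtain a where a: "a \<in> e" "a \<notin> B" using e by blast
      obtain b where b: "e = {a, b}" "a \<noteq> b" using simple_graph_edgeE[OF G _ a(1)] e by blast
      then have ab: "{a, b} \<in> E" "a \<in> V" "b \<in> V" using e ED by auto
      then have "overlap (f a) (f b)" using ov b by auto
      then obtain s t where "s \<in> f a \<inter> f b" "t \<in> f a - f b" by (auto simp: overlap_def)
      then have "Q e (if b \<in> B then t else s)" "(if b \<in> B then t else s) \<in> ?U"
        using a b ab by (auto simp: Q_def)
      then show ?thesis by blast
    qed
    then obtain el where el: "\<And>e. e \<in> ?E1 \<Longrightarrow> el e \<in> ?U \<and> Q e (el e)" by metis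
    have edge_eq: "e = {a, c}"
      if e: "e \<in> E" "a \<in> e" and "a \<notin> B" "c \<in> V" "c \<notin> B" "a \<noteq> c" "s \<in> f c" "Q e s" for e a c s
    proof -
      obtain b where b: "e = {a, b}" "a \<noteq> b" using simple_graph_edgeE[OF G e] by blast
      have V: "a \<in> V" "b \<in> V" and ab: "{a, b} \<in> E" using ED b e(1) by auto
      have "s \<in> f a" using that b by (auto simp: Q_def)
      then have ac: "{a, c} \<in> E" using nonB[of a c s] that V by auto
      \<comment> \<open>A big end different from \<open>c\<close> would have a set containing \<open>f c\<close>, and a non-big one would lie in a triangle with \<open>a\<close> and \<open>c\<close>.\<close>
      have "b = c"
      proof (rule ccontr)
        assume "b \<noteq> c"
        have bc: "{b, c} \<notin> E" using triangle_freeD[OF tri ab _ ac] by blast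
        show False
        proof (cases "b \<in> B")
          case True
          then have "f c \<subseteq> f b" using B[of b c] bc that \<open>b \<noteq> c\<close> by auto
          then show False using that True b by (auto simp: Q_def)
        next
          case False
          then have "s \<in> f b" using that b by (auto simp: Q_def)
          then show False using nonB[of b c s] False V that bc \<open>b \<noteq> c\<close> by auto
        qed
      qed
      then show ?thesis using b by simp
    qed
    have "inj_on el ?E1"
    proof (rule inj_onI)
      fix e e' assume e: "e \<in> ?E1" and e': "e' \<in> ?E1" and eq: "el e = el e'"
      define s where "s = el e"
      have Q: "Q e s" "Q e' s" using el[OF e] el[OF e'] eq by (auto simp: s_def)
      have key: "e = e'" if "a \<in> e - B" "c \<in> e' - B" "a \<noteq> c" for a c
      proof -
        have "a \<in> V" "c \<in> V" using G e e' that by (auto simp: simple_graph_def)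
        moreover have "s \<in> f a" "s \<in> f c" using Q that by (auto simp: Q_def)
        ultimately show ?thesis
          using edge_eq[of e a c s] edge_eq[of e' c a s] that e e' Q by auto
      qed
      show "e = e'"
      proof (rule ccontr)
        assume ne: "e \<noteq> e'"
        obtain a where a: "a \<in> e - B" using e by blast
        obtain c where c: "c \<in> e' - B" using e' by blast
        have "a = c" using key[OF a c] ne by blast
        obtain b where b: "e = {a, b}" "a \<noteq> b" using simple_graph_edgeE[OF G, of e a] e a by blast
        obtain d where d: "e' = {a, d}" "a \<noteq> d"
          using simple_graph_edgeE[OF G, of e' a] e' c \<open>a = c\<close> by blast
        have "b \<in> B" using key[of b c] b c \<open>a = c\<close> ne by auto
        moreover have "d \<in> B" using key[of a d] d a ne by auto
        moreover have "b \<noteq> d" using ne b d by auto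
        ultimately have "{b, d} \<in> E" using True by blast
        then show False using triangle_freeD[OF tri, of a b d] b d e e' by auto
      qed
    qed
    then have "card ?E1 \<le> card ?U"
      using el finU by (intro card_inj_on_le[of el]) auto
    \<comment> \<open>Two edges between big vertices would span a triangle.\<close>
    moreover have "card (E - ?E1) \<le> Suc 0"
    proof -
      have "e = e'" if "e \<in> E" "e' \<in> E" "e \<subseteq> B" "e' \<subseteq> B" for e e'
      proof (rule ccontr)
        assume ne: "e \<noteq> e'"
        have c2: "card e = 2" "card e' = 2" using G that by (auto simp: simple_graph_def)
        then have "\<not> e' \<subseteq> e" using ne
          by (metis card_subset_eq card_eq_0_iff zero_neq_numeral)
        then obtain c where c: "c \<in> e'" "c \<notin> e" by blast
        obtain a b where ab: "e = {a, b}" "a \<noteq> b" using c2 by (auto simp: card_2_iff)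
        then have "{a, b} \<in> E" "{b, c} \<in> E" "{a, c} \<in> E" using True that c by auto
        then show False using triangle_freeD[OF tri] by blast
      qed
      then show ?thesis using finE by (subst card_le_Suc0_iff_eq) auto
    qed
    moreover have "card E = card ?E1 + card (E - ?E1)"
      using finE card_Un_disjoint[of ?E1 "E - ?E1"] by (auto simp: Un_absorb1)
    ultimately show ?thesis by (simp add: representation_size_def)
  next
    case False
    then obtain x x' where xx: "x \<in> B" "x' \<in> B" "x \<noteq> x'" "{x, x'} \<notin> E" by blast
    have V: "x \<in> V" "x' \<in> V" using xx by (auto simp: B_def)
    have "f x = f x'" using B[of x x'] B[of x' x] xx V by (auto simp: insert_commute)
    then have tw: "{x, y} \<in> E \<longleftrightarrow> {x', y} \<in> E" if "y \<in> V" "y \<noteq> x" "y \<noteq> x'" for y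
      using ov[of x y] ov[of x' y] that V by auto
    define N where "N = {y. {x, y} \<in> E}"
    have NV: "N \<subseteq> V" using ED by (auto simp: N_def)
    have Veq: "z \<in> N" if z: "z \<in> V" "z \<noteq> x" "z \<noteq> x'" for z
    proof (rule ccontr)
      assume "z \<notin> N"
      then have "joined {e \<in> E. e \<subseteq> V - insert x {y. {x, y} \<in> E}} x' z"
        using joined_off_neighbourhood[OF G S V(1), of x' z] xx z V by (auto simp: N_def)
      then obtain w where "w \<noteq> x'" "{x', w} \<in> E" "w \<in> V" "{x, w} \<notin> E" "w \<noteq> x"
        using joined_exit[of _ x' z "{x'}"] z by blast
      then show False using tw by blast
    qed
    have ind: "{p, q} \<notin> E" if "p \<in> N" "q \<in> N" for p q
      using that triangle_freeD[OF tri, of x p q] by (auto simp: N_def)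
    have "card N \<le> 2"
    proof (rule ccontr)
      assume "\<not> card N \<le> 2"
      then obtain T where "T \<subseteq> N" "card T = 3"
        using obtain_subset_with_card_n[of 3 N] by auto
      then obtain p q r where pqr: "p \<in> N" "q \<in> N" "r \<in> N" "p \<noteq> q" "p \<noteq> r" "q \<noteq> r"
        by (auto simp: card_3_iff)
      have px: "{p, x} \<in> E" using pqr by (auto simp: N_def insert_commute)
      have "p \<noteq> x'" "p \<noteq> x" using pqr xx px ED(3) by (auto simp: N_def)
      then have px': "{p, x'} \<in> E" using tw[of p] pqr NV by (auto simp: N_def insert_commute)
      have "joined {e \<in> E. e \<subseteq> V - insert p {y. {p, y} \<in> E}} q r"
        using joined_off_neighbourhood[OF G S, of p q r] pqr NV ind by auto
      then obtain w where w: "w \<noteq> q" "{q, w} \<in> E" "w \<in> V" "{p, w} \<notin> E"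
        using joined_exit[of _ q r "{q}"] pqr by blast
      then have "w \<in> N" using Veq[of w] px px' by blast
      then show False using ind w pqr by blast
    qed
    have "E \<subseteq> (\<lambda>(p, q). {p, q}) ` ({x, x'} \<times> N)"
    proof
      fix e assume e: "e \<in> E"
      then have "e \<noteq> {}" using G by (auto simp: simple_graph_def)
      then obtain a where "a \<in> e" by blast
      then obtain b where b: "e = {a, b}" "a \<noteq> b" using simple_graph_edgeE[OF G e] by blast
      then have ab: "{a, b} \<in> E" "a \<in> V" "b \<in> V" using ED e by auto
      have "\<not> (a \<in> N \<and> b \<in> N)" using ind ab by blast
      moreover have "\<not> ({a, b} = {x, x'})" using ab xx by auto
      ultimately have "a \<in> {x, x'} \<and> b \<in> N \<or> b \<in> {x, x'} \<and> a \<in> N"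
        using Veq[of a] Veq[of b] ab b(2) by blast
      then show "e \<in> (\<lambda>(p, q). {p, q}) ` ({x, x'} \<times> N)"
        using b by (auto simp: insert_commute)
    qed
    then have "card E \<le> card ({x, x'} \<times> N)"
      using NV finV by (intro surj_card_le) (auto intro: finite_subset)
    also have "\<dots> = 2 * card N" using xx by (simp add: card_cartesian_product)
    \<comment> \<open>Four edges need only three elements, and one overlapping pair of sets already has three.\<close>
    finally have E4: "card E \<le> 4" using \<open>card N \<le> 2\<close> by simp
    show ?thesis
    proof (cases "E = {}")
      case False
      then obtain e where e: "e \<in> E" by blast
      then have "card e = 2" using G by (auto simp: simple_graph_def)
      then obtain a b where ab: "e = {a, b}" "a \<noteq> b" by (auto simp: card_2_iff)
      then have abV: "a \<in> V" "b \<in> V" using ED e by auto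
      then have "overlap (f a) (f b)" using ov ab e by auto
      then obtain r s t where rst: "r \<in> f a \<inter> f b" "s \<in> f a - f b" "t \<in> f b - f a"
        by (auto simp: overlap_def)
      then have "r \<noteq> s" "r \<noteq> t" "s \<noteq> t" by blast+
      then have "card {r, s, t} = 3" by simp
      moreover have "{r, s, t} \<subseteq> ?U" using rst abV by auto
      ultimately have "3 \<le> card ?U" using finU card_mono by metis
      then show ?thesis using E4 by (simp add: representation_size_def)
    qed simp
  qed
qed

section \<open>An overlap representation with one element fewer than edges\<close>

text \<open>The incidence assignment, in which disjointness represents non-adjacency, with the sets of the
  vertices in \<open>d\<close> complemented.\<close>

definition flipped_incidence :: "'a set set \<Rightarrow> 'a set \<Rightarrow> 'a \<Rightarrow> 'a set set" where
  "flipped_incidence E d w = {e \<in> E. w \<in> e \<longleftrightarrow> w \<notin> d}"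

text \<open>Complementation turns the disjointness of \<open>u\<close> from a non-neighbour into containment, and keeps the
  overlap with a neighbour \<open>b\<close>: the edge \<open>ub\<close> is now the element that \<open>u\<close> misses, while another
  edge at \<open>b\<close> is shared. Edges at \<open>u\<close> or \<open>v\<close> other than \<open>uv\<close> witness that neither of these two sets is
  contained in the other, and a path of length two starting at \<open>u\<close> leads to an edge in both.\<close>

lemma overlap_flipped_incidence:
  assumes G: "simple_graph V E" and tri: "triangle_free E"
    and deg: "\<And>x y. x \<in> V \<Longrightarrow> \<exists>y'. {x, y'} \<in> E \<and> y' \<noteq> y"
    and uv: "{u, v} \<in> E"
  shows "overlap_representation V E (flipped_incidence E {u, v})"
proof -
  let ?f = "flipped_incidence E {u, v}"
  note ED = simple_graph_edgeD[OF G]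
  have sym: "overlap A B \<longleftrightarrow> overlap B A" for A B :: "'a set set" by (auto simp: overlap_def)
  have eq: "e = {a, b}" if "e \<in> E" "a \<in> e" "b \<in> e" "a \<noteq> b" for e a b
    using simple_graph_edgeE[OF G that(1,2)] that(3,4) by blast
  have ord: "overlap (?f a) (?f b) \<longleftrightarrow> {a, b} \<in> E"
    if ab: "a \<in> V" "b \<in> V" "a \<noteq> b" "a \<notin> {u, v}" "b \<notin> {u, v}" for a b
  proof
    assume "overlap (?f a) (?f b)"
    then obtain e where "e \<in> E" "a \<in> e" "b \<in> e"
      using ab by (auto simp: overlap_def flipped_incidence_def)
    then show "{a, b} \<in> E" using eq ab by metis
  next
    assume e: "{a, b} \<in> E"
    obtain a' b' where "{a, a'} \<in> E" "a' \<noteq> b" "{b, b'} \<in> E" "b' \<noteq> a" using deg ab by meson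
    then have "{a, b} \<in> ?f a \<inter> ?f b" "{a, a'} \<in> ?f a - ?f b" "{b, b'} \<in> ?f b - ?f a"
      using e ab by (auto simp: flipped_incidence_def)
    then show "overlap (?f a) (?f b)" unfolding overlap_def by blast
  qed
  have mixed: "overlap (?f a) (?f b) \<longleftrightarrow> {a, b} \<in> E"
    if ab: "b \<in> V" "b \<notin> {u, v}" "{a, a'} = {u, v}" for a a' b
  proof
    assume "overlap (?f a) (?f b)"
    then obtain e where "e \<in> E" "b \<in> e" "a \<in> e"
      using ab by (auto simp: overlap_def flipped_incidence_def)
    then show "{a, b} \<in> E" using eq[of e a b] ab by auto
  next
    assume e: "{a, b} \<in> E"
    have aa: "{a, a'} \<in> E" using uv ab by simp
    have aV: "a \<in> V" "a' \<in> V" "a \<noteq> a'" using ED[OF aa] by auto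
    obtain q where q: "{b, q} \<in> E" "q \<noteq> a" using deg ab by meson
    obtain c where c: "{a', c} \<in> E" "c \<noteq> a" using deg aV by meson
    have "b \<noteq> c" using triangle_freeD[OF tri, of a a' b] aa e c by auto
    have m: "a \<in> {u, v}" "a' \<in> {u, v}" "b \<noteq> a" "b \<noteq> a'" using ab by auto
    have "{b, q} \<in> ?f a \<inter> ?f b" "{a, b} \<in> ?f b - ?f a" "{a', c} \<in> ?f a - ?f b"
      using e q c m ab(2) aV \<open>b \<noteq> c\<close> unfolding flipped_incidence_def by auto
    then show "overlap (?f a) (?f b)" unfolding overlap_def by blast
  qed
  have both: "overlap (?f u) (?f v)"
  proof -
    have V: "u \<in> V" "v \<in> V" "u \<noteq> v" using ED[OF uv] by auto
    obtain p where p: "{u, p} \<in> E" "p \<noteq> v" using deg V by meson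
    obtain r where r: "{v, r} \<in> E" "r \<noteq> u" using deg V by meson
    have "p \<in> V" "p \<noteq> u" using ED[OF p(1)] by auto
    obtain q where q: "{p, q} \<in> E" "q \<noteq> u" using deg \<open>p \<in> V\<close> by meson
    have "q \<noteq> v" using triangle_freeD[OF tri, of u p v] p q uv by auto
    then have "{p, q} \<in> ?f u \<inter> ?f v" "{u, p} \<in> ?f v - ?f u" "{v, r} \<in> ?f u - ?f v"
      using p q r V \<open>p \<noteq> u\<close> by (auto simp: flipped_incidence_def)
    then show ?thesis unfolding overlap_def by blast
  qed
  show ?thesis
    unfolding overlap_representation_def
  proof (intro ballI impI)
    fix a b assume ab: "a \<in> V" "b \<in> V" "a \<noteq> b"
    consider "a \<notin> {u, v}" "b \<notin> {u, v}" | "a \<in> {u, v}" "b \<notin> {u, v}" | "a \<notin> {u, v}" "b \<in> {u, v}"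
      | "a = u" "b = v" | "a = v" "b = u"
      using ab by auto
    then show "({a, b} \<in> E) = overlap (?f a) (?f b)"
    proof cases
      case 1 then show ?thesis using ord ab by auto
    next
      case 2
      then obtain a' where "{a, a'} = {u, v}" by auto
      then show ?thesis using mixed[of b a] 2 ab by auto
    next
      case 3
      then obtain b' where "{b, b'} = {u, v}" by auto
      then show ?thesis using mixed[of a b] 3 ab sym[of "?f a"] by (auto simp: insert_commute)
    next
      case 4 then show ?thesis using both uv by simp
    next
      case 5 then show ?thesis using both uv sym by (simp add: insert_commute)
    qed
  qed
qed

lemma overlap_image:
  assumes "inj_on h U" "A \<subseteq> U" "B \<subseteq> U"
  shows "overlap (h ` A) (h ` B) \<longleftrightarrow> overlap A B"
  unfolding overlap_def
  using inj_on_image_Int[OF assms] inj_on_image_subset_iff[OF assms]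
    inj_on_image_subset_iff[OF assms(1,3,2)]
  by auto

theorem overlap_number_no_star_cutset:
  assumes G: "simple_graph V E" and tri: "triangle_free E" and S: "\<not> (\<exists>S. star_cutset V E S)"
    and "3 \<le> card V" "E \<noteq> {}"
  shows "Suc (overlap_number V E) = card E"
proof -
  have finE: "finite E" using G by (rule simple_graph_finite_edges)
  obtain e where "e \<in> E" using assms(5) by blast
  then have "card e = 2" using G by (auto simp: simple_graph_def)
  then obtain u v where "e = {u, v}" by (auto simp: card_2_iff)
  then have uv: "{u, v} \<in> E" using \<open>e \<in> E\<close> by simp
  let ?f = "flipped_incidence E {u, v}"
  have f: "overlap_representation V E ?f"
    using another_neighbour_if_no_star_cutset[OF G S assms(4,5)]
    by (intro overlap_flipped_incidence[OF G tri _ uv]) metis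
  obtain h :: "'a set \<Rightarrow> nat" where h: "inj_on h E"
    using finite_imp_inj_to_nat_seg[OF finE] by blast
  define g where "g v = h ` ?f v" for v
  have fE: "?f v \<subseteq> E" for v by (auto simp: flipped_incidence_def)
  have g: "overlap_representation V E g"
    using f overlap_image[OF h fE fE] by (simp add: overlap_representation_def g_def)
  moreover have fin: "\<forall>v\<in>V. finite (g v)"
    using finE fE by (auto simp: g_def intro: finite_subset)
  moreover have "representation_size V g = card E - 1"
  proof (rule antisym)
    \<comment> \<open>The edge between the two complemented vertices is in no set, which saves the one element.\<close>
    have "(\<Union>w\<in>V. g w) \<subseteq> h ` (E - {{u, v}})"
      unfolding g_def flipped_incidence_def by auto
    then have "card (\<Union>w\<in>V. g w) \<le> card (h ` (E - {{u, v}}))"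
      using finE by (intro card_mono) auto
    also have "\<dots> \<le> card (E - {{u, v}})" using finE by (intro card_image_le) auto
    also have "\<dots> = card E - 1" using uv finE by simp
    finally show "representation_size V g \<le> card E - 1" by (simp add: representation_size_def)
    show "card E - 1 \<le> representation_size V g"
      using card_edges_le_size[OF G tri S g fin] by simp
  qed
  ultimately have "overlap_number V E = card E - 1"
    unfolding overlap_number_def
    using card_edges_le_size[OF G tri S, where 'b = nat]
    by (intro Least_equality) (auto simp: le_diff_conv)
  then show ?thesis using uv finE by (metis Suc_pred' card_gt_0_iff empty_iff)
qed

section \<open>Plane graphs with faces of length four\<close>

text \<open>Without cut-edges the length of a face is the number of edges on its frontier, and every edge is
  on the frontier of two faces.\<close>

lemma double_count_face_lengths:
  assumes P: "plane_graph V E pos curve" and cut: "\<And>e. \<not> cut_edge E e"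
    and fin: "finite (faces V E pos curve)"
  shows "(\<Sum>F\<in>faces V E pos curve. face_length E curve F) = 2 * card E"
proof -
  have finE: "finite E" using plane_graphD(1)[OF P] by (rule simple_graph_finite_edges)
  have "(\<Sum>F\<in>faces V E pos curve. face_length E curve F) =
      (\<Sum>F\<in>faces V E pos curve. card {e \<in> E. path_image (curve e) \<subseteq> frontier F})"
    using cut by (simp add: face_length_def boundary_edges_def)
  also have "\<dots> = 2 * card E"
    by (rule sum_multicount) (use fin finE two_faces_per_edge[OF P _ cut] in auto)
  finally show ?thesis .
qed

lemma card_edges_le_1:
  assumes "simple_graph V E" "card V \<le> 2"
  shows "card E \<le> 1"
proof -
  have "finite V" using assms by (simp add: simple_graph_def)
  have "e = V" if "e \<in> E" for e
    using assms that by (intro card_seteq \<open>finite V\<close>) (auto simp: simple_graph_def)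
  then have "E \<subseteq> {V}" by auto
  then show ?thesis using card_mono[of "{V}" E] by simp
qed

text \<open>A graph on at most two vertices has at most one edge, and each edge contributes at most two to the
  length of a face.\<close>

lemma card_ge_3_if_face_length_4:
  assumes P: "plane_graph V E pos curve" and F: "\<forall>F\<in>faces V E pos curve. face_length E curve F = 4"
  shows "3 \<le> card V"
proof (rule ccontr)
  assume "\<not> 3 \<le> card V"
  then have E1: "card E \<le> 1" using card_edges_le_1[OF plane_graphD(1)[OF P]] by simp
  have finE: "finite E" using plane_graphD(1)[OF P] by (rule simple_graph_finite_edges)
  have "drawing V E pos curve \<noteq> UNIV" using compact_drawing[OF P] not_compact_UNIV by metis
  then have "faces V E pos curve \<noteq> {}" by (auto simp: faces_def)
  then obtain F where "F \<in> faces V E pos curve" by blast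
  then have "4 = face_length E curve F" using F by simp
  also have "\<dots> \<le> (\<Sum>e\<in>boundary_edges E curve F. 2)"
    unfolding face_length_def by (rule sum_mono) simp
  also have "\<dots> = 2 * card (boundary_edges E curve F)" by simp
  also have "\<dots> \<le> 2 * card E" using finE by (simp add: boundary_edges_def card_mono)
  finally show False using E1 by simp
qed

theorem corollary3p12:
  fixes V :: "'a set" and E :: "'a set set" and n :: nat
    and pos :: "'a \<Rightarrow> complex" and curve :: "'a set \<Rightarrow> real \<Rightarrow> complex"
  assumes "plane_graph V E pos curve"
    and "card V = n"
    and "triangle_free E"
    and "\<forall>F\<in>faces V E pos curve. face_length E curve F = 4"
    and "\<not> (\<exists>S. star_cutset V E S)"
  shows "int (overlap_number V E) = 2 * int n - 5"
proof -
  note P = assms(1)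
  have G: "simple_graph V E" using plane_graphD(1)[OF P] .
  have n3: "3 \<le> card V" using card_ge_3_if_face_length_4[OF P assms(4)] .
  then have "V \<noteq> {}" by auto
  have "E \<noteq> {}"
  proof
    assume "E = {}"
    moreover have "drawing V E pos curve \<noteq> UNIV" using compact_drawing[OF P] not_compact_UNIV by metis
    ultimately show False using assms(4) by (auto simp: faces_def face_length_def boundary_edges_def)
  qed
  note con = joined_if_no_star_cutset[OF G assms(5) \<open>E \<noteq> {}\<close>]
  note euler = euler_formula[OF P \<open>V \<noteq> {}\<close> con]
  have "(\<Sum>F\<in>faces V E pos curve. face_length E curve F) = 2 * card E"
    using double_count_face_lengths[OF P no_cut_edge_if_no_star_cutset[OF G assms(5) n3] euler(1)] .
  then have "4 * card (faces V E pos curve) = 2 * card E" using assms(4) by simp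
  moreover have "Suc (overlap_number V E) = card E"
    using overlap_number_no_star_cutset[OF G assms(3,5) n3 \<open>E \<noteq> {}\<close>] .
  ultimately show ?thesis using euler(2) assms(2) by linarith
qed

end
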